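(* Let $P$ be a stochastic matrix over the finite set $X = X^o \cup \partial X$ satisfying properties (i), (ii), (iii) listed in the context, and let $n\ge 1$ be an integer. A function $f: X\to\mathbb{C}$ satisfies $(I-P)^n f = 0$ on $X$ if and only if $f$ is harmonic.
   Context: $X$ is a finite set, the disjoint union of two non-empty subsets $X^o$ (the interior) and $\partial X$ (the boundary). $P = (p(x,y))_{x,y\in X}$ is a stochastic matrix (non-negative entries, row sums $1$), and $p^{(n)}(x,y)$ denotes the $(x,y)$-entry of $P^n$. The standing assumptions are: (i) for every $x\in X^o$ there is $w\in\partial X$ with $p^{(n)}(x,w)>0$ for some $n$; (ii) for every $w\in\partial X$, $p(w,w)=1$, and thus $p(w,x)=0$ for all $x\in X\setminus\{w\}$; (iii) for every $w\in\partial X$ there is $x\in X^o$ with $p^{(n)}(x,w)>0$ for some $n$. $P$ acts on functions (column vectors) $f:X\to\mathbb{C}$ by $Pf(x)=\sum_{y\in X} p(x,y)f(y)$, and $I$ is the identity matrix over $X$. A function $h:X\to\mathbb{C}$ is called harmonic if $Ph(x)=h(x)$ for every $x\in X^o$. *)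

theory Defs
  imports "HOL-Analysis.Analysis"
begin

text \<open>The library operations \<open>*\<close> and \<open>^\<close> on \<^typ>\<open>real^'n^'n\<close> are entrywise; these are powers with
  respect to the matrix product \<open>**\<close>.\<close>

primrec matrix_power :: "'a::semiring_1^'n^'n \<Rightarrow> nat \<Rightarrow> 'a^'n^'n" where
  "matrix_power A 0 = mat 1"
| "matrix_power A (Suc n) = A ** matrix_power A n"

definition stochastic_matrix :: "real^'x^'x \<Rightarrow> bool" where
  "stochastic_matrix P \<longleftrightarrow> (\<forall>x y. 0 \<le> P $ x $ y) \<and> (\<forall>x. (\<Sum>y\<in>UNIV. P $ x $ y) = 1)"

abbreviation complex_matrix :: "real^'n^'m \<Rightarrow> complex^'n^'m" where
  "complex_matrix \<equiv> map_matrix complex_of_real"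

definition harmonic :: "real^'x^'x \<Rightarrow> 'x set \<Rightarrow> complex^'x \<Rightarrow> bool" where
  "harmonic P Xo h \<longleftrightarrow> (\<forall>x\<in>Xo. (complex_matrix P *v h) $ x = h $ x)"

end

(* Only (I - P)^2 f = 0 ==> (I - P) f = 0 needs an argument. With g = (I - P) f one has P g = g,
   hence P^k f = f - k g for all k. Since P does not increase the sup norm, the left side stays
   bounded, which forces g = 0. Absorption at the boundary makes P f = f automatic there. *)
theory Submission
  imports Defs
begin

text \<open>Once squaring adds nothing to the kernel of \<open>A\<close>, no higher power does: the
  hypothesis, applied to \<open>matrix_power A n *v v\<close>, strips one factor \<open>A\<close>
  per induction step.\<close>

lemma matrix_power_kernel_eq:
  fixes A :: "'a::semiring_1^'n^'n"
  assumes "\<And>v. A *v (A *v v) = 0 \<Longrightarrow> A *v v = 0"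
  shows "matrix_power A (Suc n) *v v = 0 \<longleftrightarrow> A *v v = 0"
proof (induction n)
  case (Suc n)
  let ?w = "matrix_power A n *v v"
  have step: "matrix_power A (Suc n) *v v = A *v ?w"
    "matrix_power A (Suc (Suc n)) *v v = A *v (A *v ?w)"
    by (simp_all add: matrix_vector_mul_assoc)
  have "A *v (A *v ?w) = 0 \<longleftrightarrow> A *v ?w = 0"
    using assms by (metis matrix_vector_mult_0_right)
  then show ?case
    using Suc.IH step by simp
qed simp

text \<open>Each entry of the image is a convex combination of the entries of \<open>v\<close>, so a
  common bound on their moduli survives.\<close>

lemma stochastic_matrix_mult_norm_le:
  assumes P: "stochastic_matrix P" and v: "\<And>y. norm (v $ y) \<le> M"
  shows "norm ((complex_matrix P *v v) $ x) \<le> M"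
proof -
  have "norm ((complex_matrix P *v v) $ x) \<le> (\<Sum>y\<in>UNIV. P $ x $ y * norm (v $ y))"
    using P by (auto simp: matrix_vector_mult_def map_matrix_def stochastic_matrix_def norm_mult
        intro!: sum_norm_le)
  also have "\<dots> \<le> (\<Sum>y\<in>UNIV. P $ x $ y * M)"
    using P v by (intro sum_mono mult_left_mono) (auto simp: stochastic_matrix_def)
  also have "\<dots> = M"
    using P by (simp add: stochastic_matrix_def flip: sum_distrib_right)
  finally show ?thesis .
qed

lemma stochastic_matrix_kernel_square:
  fixes f :: "complex^'x" and P :: "real^'x^'x"
  defines "A \<equiv> mat 1 - complex_matrix P"
  assumes P: "stochastic_matrix P" and A2: "A *v (A *v f) = 0"
  shows "A *v f = 0"
proof -
  define g where "g = A *v f"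
  have Pf: "complex_matrix P *v f = f - g"
    by (simp add: g_def A_def matrix_vector_mult_diff_rdistrib)
  have Pg: "complex_matrix P *v g = g"
    using A2 unfolding g_def[symmetric] by (simp add: A_def matrix_vector_mult_diff_rdistrib)
  \<comment> \<open>The Euclidean \<open>norm f\<close> serves merely as one bound for all entries
    of \<open>f\<close>. Generalizing over \<open>x\<close> is essential, since an entry of the next
    vector averages over all entries of the previous one.\<close>
  have bound: "norm ((f - of_nat k *s g) $ x) \<le> norm f" for k x
  proof (induction k arbitrary: x)
    case 0
    then show ?case
      by (simp add: Finite_Cartesian_Product.norm_nth_le)
  next
    case (Suc k)
    have "complex_matrix P *v (f - of_nat k *s g) = f - of_nat (Suc k) *s g"
      by (simp add: matrix_vector_mult_diff_distrib vector_scalar_commute Pf Pg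
          vector_sadd_rdistrib)
    then show ?case
      using stochastic_matrix_mult_norm_le[OF P Suc.IH] by metis
  qed
  have "g $ x = 0" for x
  proof (rule ccontr)
    assume "g $ x \<noteq> 0"
    \<comment> \<open>The threshold is twice \<open>norm f\<close> because \<open>k\<close> times
      \<open>g $ x\<close> is the difference of two entries, those of the iterates 0 and
      \<open>k\<close>, each bounded by \<open>norm f\<close>.\<close>
    then obtain k :: nat where k: "2 * norm f < real k * norm (g $ x)"
      using reals_Archimedean3[of "norm (g $ x)"] by auto
    have "real k * norm (g $ x) = norm (f $ x - (f - of_nat k *s g) $ x)"
      by (simp add: norm_mult)
    also have "\<dots> \<le> norm (f $ x) + norm ((f - of_nat k *s g) $ x)"
      by (rule norm_triangle_ineq4)
    also have "\<dots> \<le> 2 * norm f"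
      using bound[of 0 x] bound[of k x] by simp
    finally show False
      using k by simp
  qed
  then show ?thesis
    by (simp add: vec_eq_iff flip: g_def)
qed

text \<open>The diagonal entry uses up the whole row sum, so by non-negativity row \<open>w\<close>
  of \<open>P\<close> is the unit vector at \<open>w\<close>.\<close>

lemma stochastic_matrix_absorbing:
  assumes P: "stochastic_matrix P" and w: "P $ w $ w = 1"
  shows "(complex_matrix P *v f) $ w = f $ w"
proof -
  have "(\<Sum>y\<in>UNIV - {w}. P $ w $ y) = 0"
    using P w by (simp add: stochastic_matrix_def sum_diff1)
  then have "P $ w $ y = 0" if "y \<noteq> w" for y
    using P that by (subst (asm) sum_nonneg_eq_0_iff) (auto simp: stochastic_matrix_def)
  then have "(\<Sum>y\<in>UNIV. of_real (P $ w $ y) * f $ y) = (\<Sum>y\<in>UNIV. if y = w then f $ y else 0)"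
    using w by (intro sum.cong) auto
  then show ?thesis
    by (simp add: matrix_vector_mult_def map_matrix_def)
qed

theorem mainTheorem3:
  fixes P :: "real^'x^'x" and Xo dX :: "'x set" and n :: nat and f :: "complex^'x"
  assumes "stochastic_matrix P"
    and "Xo \<union> dX = UNIV" and "Xo \<inter> dX = {}" and "Xo \<noteq> {}" and "dX \<noteq> {}"
    and "\<And>x. x \<in> Xo \<Longrightarrow> \<exists>w\<in>dX. \<exists>k. matrix_power P k $ x $ w > 0"
    and "\<And>w. w \<in> dX \<Longrightarrow> P $ w $ w = 1"
    and "\<And>w. w \<in> dX \<Longrightarrow> \<exists>x\<in>Xo. \<exists>k. matrix_power P k $ x $ w > 0"
    and "n \<ge> 1"
  shows "matrix_power (mat 1 - complex_matrix P) n *v f = 0 \<longleftrightarrow> harmonic P Xo f"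
proof -
  let ?A = "mat 1 - complex_matrix P"
  obtain m where n: "n = Suc m"
    using \<open>n \<ge> 1\<close> by (cases n) auto
  have "matrix_power ?A n *v f = 0 \<longleftrightarrow> ?A *v f = 0"
    unfolding n
    by (rule matrix_power_kernel_eq) (rule stochastic_matrix_kernel_square[OF assms(1)])
  also have "\<dots> \<longleftrightarrow> (\<forall>x. (complex_matrix P *v f) $ x = f $ x)"
    by (auto simp: matrix_vector_mult_diff_rdistrib vec_eq_iff)
  \<comment> \<open>Every point outside \<open>Xo\<close> lies in \<open>dX\<close>, where
    absorption gives the equation for any \<open>f\<close>; only the interior equations
    remain.\<close>
  also have "\<dots> \<longleftrightarrow> harmonic P Xo f"
    using assms(2) stochastic_matrix_absorbing[OF assms(1) assms(7)]
    unfolding harmonic_def by blast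
  finally show ?thesis .
qed

end
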